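(* We have $$\sum_{k=1}^{\infty}\frac{H_k-2H_{2k}}{(-3)^k\, k}=\frac{\pi^2}{18}.$$
   Context: For a non-negative integer $k$, $H_k=\sum_{j=1}^k \frac{1}{j}$ denotes the $k$-th harmonic number. *)

theory Defs
  imports "HOL-Analysis.Analysis"
begin

end

theory Submission
  imports Defs
begin

text \<open>
  Since \<open>H\<^sub>2\<^sub>k - H\<^sub>k / 2 = 1 + 1/3 + \<dots> + 1/(2k - 1)\<close>, the series is twice the
  Cauchy square of the Leibniz series of \<open>arctan\<close>, evaluated at \<open>1 / sqrt 3\<close>: it equals
  \<open>2 * (arctan (1 / sqrt 3))\<^sup>2 = 2 * (pi / 6)\<^sup>2\<close>.
\<close>

lemma harm_double_Suc:
  "harm (2 * Suc n) = harm (2 * n) + 1 / (2 * real n + 1) + 1 / (real (Suc n) * 2)"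
proof -
  have "2 * Suc n = Suc (Suc (2 * n))" by simp
  then have "harm (2 * Suc n)
      = harm (2 * n) + inverse (real (Suc (2 * n))) + inverse (real (Suc (Suc (2 * n))))"
    by (simp only: harm_Suc)
  moreover have "real (Suc (2 * n)) = 2 * real n + 1" "real (Suc (Suc (2 * n))) = real (Suc n) * 2"
    by simp_all
  ultimately show ?thesis by (simp only: inverse_eq_divide)
qed

text \<open>The even-indexed terms of \<open>harm (2 * n)\<close> add up to half of
  \<open>harm n\<close>; removing them leaves the odd reciprocals.\<close>

lemma sum_odd_reciprocals_eq_harm:
  "(\<Sum>i<n. 1 / (2 * real i + 1)) = harm (2 * n) - harm n / 2"
proof (induction n)
  case 0
  show ?case by (simp add: harm_expand(1))
next
  case (Suc n)
  have "(harm (Suc n) :: real) / 2 = harm n / 2 + 1 / (real (Suc n) * 2)"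
    by (simp only: harm_Suc add_divide_distrib inverse_eq_divide divide_divide_eq_left)
  then show ?case
    using Suc unfolding harm_double_Suc sum.lessThan_Suc by linarith
qed

text \<open>The two factors of each denominator add up to \<open>2 * (n + 1)\<close>, independently
  of \<open>i\<close>. Partial fractions therefore split the sum into two sums over a common
  denominator, and the reflection of \<open>i\<close> to \<open>n - i\<close> makes these equal,
  cancelling the 2.\<close>

lemma sum_odd_reciprocal_products:
  "(\<Sum>i\<le>n. 1 / ((2 * real i + 1) * (2 * real (n - i) + 1)))
     = (\<Sum>i\<le>n. 1 / (2 * real i + 1)) / (real n + 1)"
proof -
  have "1 / ((2 * real i + 1) * (2 * real (n - i) + 1))
      = (1 / (2 * real i + 1) + 1 / (2 * real (n - i) + 1)) / (2 * (real n + 1))"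
    if "i \<in> {..n}" for i
  proof -
    have partial_fractions: "1 / (a * b) = (1 / a + 1 / b) / (a + b)"
      if "a > 0" "b > 0" for a b :: real
      using that by (simp add: divide_simps)
    have denominator: "2 * (real n + 1) = (2 * real i + 1) + (2 * real (n - i) + 1)"
      using that by (simp add: of_nat_diff)
    show ?thesis
      unfolding denominator by (rule partial_fractions) simp_all
  qed
  then have "(\<Sum>i\<le>n. 1 / ((2 * real i + 1) * (2 * real (n - i) + 1)))
     = (\<Sum>i\<le>n. (1 / (2 * real i + 1) + 1 / (2 * real (n - i) + 1)) / (2 * (real n + 1)))"
    by (rule sum.cong[OF refl])
  also have "\<dots> = ((\<Sum>i\<le>n. 1 / (2 * real i + 1)) + (\<Sum>i\<le>n. 1 / (2 * real (n - i) + 1)))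
         / (2 * (real n + 1))"
    unfolding sum_divide_distrib[symmetric] sum.distrib by (rule refl)
  also have "(\<Sum>i\<le>n. 1 / (2 * real (n - i) + 1)) = (\<Sum>i\<le>n. 1 / (2 * real i + 1))"
    by (rule sum.reindex_bij_witness[of _ "\<lambda>i. n - i" "\<lambda>i. n - i"]) auto
  finally show ?thesis
    by (simp only: mult_2[symmetric] mult_divide_mult_cancel_left zero_neq_numeral not_False_eq_True)
qed

text \<open>For \<bar>x\<bar> < 1 the arctan series converges absolutely, so its Cauchy product with
  itself converges to the square. Sign and power of \<open>x\<close> depend only on
  \<open>n\<close>, which leaves the convolution of odd reciprocals.\<close>

lemma arctan_squared_sums:
  fixes x :: real
  assumes "\<bar>x\<bar> < 1"
  shows "(\<lambda>n. (-1) ^ n * x ^ (2 * Suc n) * (\<Sum>i\<le>n. 1 / (2 * real i + 1)) / real (Suc n))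
           sums (arctan x)\<^sup>2"
proof -
  define a where "a k = (-1) ^ k * (1 / real (k * 2 + 1) * x ^ (k * 2 + 1))" for k
  have "summable (\<lambda>k. norm (a k))"
  proof (rule summable_comparison_test')
    show "summable (\<lambda>k. (x\<^sup>2) ^ k)"
      using assms by (intro summable_geometric) (simp add: abs_square_less_1)
    fix k :: nat
    \<comment> \<open>Geometric majorant: the spare factor \<bar>x\<bar> is at most 1, and so is the
      coefficient \<open>1 / (2 * k + 1)\<close>.\<close>
    have "\<bar>x\<bar> ^ (k * 2 + 1) \<le> (x\<^sup>2) ^ k * 1"
      unfolding power_add mult.commute[of k 2] power_mult power2_abs power_one_right
      using assms by (intro mult_left_mono) auto
    then have "\<bar>x\<bar> ^ (k * 2 + 1) * 1 \<le> (x\<^sup>2) ^ k * (real k * 2 + 1)"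
      by (intro mult_mono) auto
    then show "norm (norm (a k)) \<le> (x\<^sup>2) ^ k"
      by (simp add: a_def abs_mult power_abs field_simps)
  qed
  then have "(\<lambda>n. \<Sum>i\<le>n. a i * a (n - i)) sums (arctan x)\<^sup>2"
    using Cauchy_product_sums[of a a] arctan_series[of x] assms
    by (simp add: a_def[abs_def] power2_eq_square)
  moreover have "(\<Sum>i\<le>n. a i * a (n - i))
      = (-1) ^ n * x ^ (2 * Suc n) * (\<Sum>i\<le>n. 1 / (2 * real i + 1)) / real (Suc n)" for n
  proof -
    have "a i * a (n - i)
        = (-1) ^ n * x ^ (2 * Suc n) * (1 / ((2 * real i + 1) * (2 * real (n - i) + 1)))"
      if "i \<in> {..n}" for i
    proof -
      \<comment> \<open>With \<open>n = i + j\<close> the truncated subtraction \<open>n - i\<close>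
        becomes \<open>j\<close>.\<close>
      obtain j where n: "n = i + j"
        using \<open>i \<in> {..n}\<close> by (auto simp: le_iff_add)
      have "x ^ (2 * Suc (i + j)) = x ^ (i * 2 + 1) * x ^ (j * 2 + 1)"
        unfolding power_add[symmetric] by (rule arg_cong[where f = "power x"]) simp
      moreover have "real (k * 2 + 1) = 2 * real k + 1" for k
        by simp
      moreover have "s * (1 / c * p) * (t * (1 / d * q)) = s * t * (p * q) * (1 / (c * d))"
        for s t c d p q :: real
        by simp
      ultimately show ?thesis
        by (simp only: n a_def power_add[of "-1"] add_diff_cancel_left')
    qed
    then have "(\<Sum>i\<le>n. a i * a (n - i)) = (-1) ^ n * x ^ (2 * Suc n)
        * (\<Sum>i\<le>n. 1 / ((2 * real i + 1) * (2 * real (n - i) + 1)))"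
      by (simp only: sum_distrib_left cong: sum.cong)
    moreover have "real (Suc n) = real n + 1"
      by simp
    ultimately show ?thesis
      by (simp only: sum_odd_reciprocal_products times_divide_eq_right)
  qed
  ultimately show ?thesis by (simp only:)
qed

theorem theorem1p1:
  shows "(\<lambda>n. let k = Suc n in
            ((harm k :: real) - 2 * harm (2 * k)) / ((-3) ^ k * real k))
         sums (pi\<^sup>2 / 18)"
proof -
  \<comment> \<open>The point \<open>1 / sqrt 3\<close> has square 1/3, which supplies the powers of
    3, and its arctan is known exactly.\<close>
  have arctan: "arctan (1 / sqrt 3) = pi / 6"
    by (rule arctan_unique) (auto simp: tan_30)
  have "(\<lambda>n. 2 * ((-1) ^ n * (1 / sqrt 3) ^ (2 * Suc n)
           * (\<Sum>i\<le>n. 1 / (2 * real i + 1)) / real (Suc n))) sums (2 * (pi / 6)\<^sup>2)"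
    unfolding arctan[symmetric] by (intro sums_mult arctan_squared_sums) simp
  moreover have "2 * ((-1) ^ n * (1 / sqrt 3) ^ (2 * Suc n)
           * (\<Sum>i\<le>n. 1 / (2 * real i + 1)) / real (Suc n))
      = (harm (Suc n) - 2 * harm (2 * Suc n)) / ((-3) ^ Suc n * real (Suc n))" for n
  proof -
    have power: "(1 / sqrt 3) ^ (2 * Suc n) = 1 / 3 ^ Suc n"
      unfolding power_mult by (simp add: power_divide)
    \<comment> \<open>The exponent of -1 is \<open>n\<close> in the Cauchy product but
      \<open>Suc n\<close> here; the extra minus sign reverses the harmonic difference in the
      numerator.\<close>
    have sign: "(-3 :: real) ^ Suc n = - ((-1) ^ n * 3 ^ Suc n)"
      by (simp add: power_minus[of "3 :: real"])
    \<comment> \<open>A sign \<open>s\<close> is its own reciprocal, so it may move into the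
      denominator.\<close>
    have "2 * (s * (1 / p) * (h' - h / 2) / m) = (h - 2 * h') / (- (s * p) * m)"
      if "s = 1 \<or> s = -1" "p > 0" "m > 0" for s p h h' m :: real
      using that by (auto simp: field_simps)
    moreover have "(-1 :: real) ^ n = 1 \<or> (-1 :: real) ^ n = -1"
      by (cases "even n") auto
    moreover have "(3 :: real) ^ Suc n > 0" "real (Suc n) > 0"
      by simp_all
    ultimately show ?thesis
      unfolding power sign lessThan_Suc_atMost[symmetric] sum_odd_reciprocals_eq_harm by blast
  qed
  moreover have "2 * (pi / 6)\<^sup>2 = pi\<^sup>2 / 18"
    by (simp add: power_divide)
  ultimately show ?thesis
    by (simp only: Let_def)
qed

end
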